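(* Let $N$ be a positive integer whose trajectory under the Collatz function reaches $1$. Then every complex root $\xi$ of the Collatz polynomial $P_N$ satisfies $$|\xi|\geq \frac{2}{3\left(1+\frac1N\right)}.$$
   Context: The Collatz function is $c(N)=\frac{3N+1}{2}$ for $N$ odd and $c(N)=\frac N2$ for $N$ even. Let $N$ be a positive integer whose trajectory $N, c(N), c(c(N)),\dots$ reaches $1$. The total stopping time $n$ of $N$ is the least $k\ge 0$ such that the $k$-th iterate of $N$ under $c$ equals $1$. Set $c^0(N)=N$, $c^k(N)=c(c^{k-1}(N))$ for $1\le k\le n$, and $c^k(N)=0$ for $k>n$. The $N$-th Collatz polynomial is $P_N(z)=\sum_{k=0}^{n}c^k(N)z^k$. *)

theory Defs
  imports Complex_Main "HOL-Computational_Algebra.Polynomial"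
begin

definition collatz :: "nat \<Rightarrow> nat" where
  "collatz N = (if odd N then (3 * N + 1) div 2 else N div 2)"

definition reaches_one :: "nat \<Rightarrow> bool" where
  "reaches_one N \<longleftrightarrow> (\<exists>k. (collatz ^^ k) N = 1)"

(* Only meaningful when reaches_one N holds; otherwise the value is unspecified. *)
definition total_stopping_time :: "nat \<Rightarrow> nat" where
  "total_stopping_time N = (LEAST k. (collatz ^^ k) N = 1)"

definition collatz_coeff :: "nat \<Rightarrow> nat \<Rightarrow> nat" where
  "collatz_coeff N k = (if k \<le> total_stopping_time N then (collatz ^^ k) N else 0)"

definition collatz_poly :: "nat \<Rightarrow> complex poly" where
  "collatz_poly N = (\<Sum>k\<le>total_stopping_time N. monom (of_nat (collatz_coeff N k)) k)"

end

theory Submission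
  imports Defs
begin

text \<open>
  Write \<open>a k\<close> for the \<open>k\<close>-th iterate of \<open>N\<close>, \<open>r = norm \<xi>\<close> and \<open>q = 3/2 * r\<close>; the claim says
  that \<open>N * (1 - q) \<le> q\<close>. A root \<open>\<xi>\<close> of \<open>P\<close> is also a root of \<open>(1 - 3/2 * z) * P(z)\<close>. This
  multiplier is chosen because an odd step of the trajectory multiplies by \<open>3/2\<close> up to an
  error \<open>1/2\<close>: the coefficient \<open>a (k+1) - 3/2 * a k\<close> of the product is \<open>1/2\<close> after an odd \<open>a k\<close>
  and \<open>- a k\<close> after an even one. So it is negative or tiny, its absolute value exceeds
  \<open>3/2 * a k - a (k+1)\<close> by \<open>1\<close> or \<open>0\<close>, and the estimate of the constant coefficient \<open>N\<close> by all
  the others telescopes to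
  \<open>(1 - q) * (\<Sum>k\<le>n. a k * r^k) \<le> (\<Sum>k<n with a k odd. r^(k+1))\<close>
  (lemma \<open>root_inequality\<close>).

  Suppose now \<open>N * (1 - q) > q\<close>, so that \<open>q < 1\<close> and \<open>r < 2/3\<close>. On the left it is enough to
  keep the terms \<open>k = 0, 1\<close>, and on the right to bound the sum by the full geometric series,
  without its first term when \<open>N\<close> is even. For odd \<open>N\<close> this leaves
  \<open>q * (1 + q) < r / (1 - r)\<close>, for even \<open>N\<close> it leaves \<open>q * (1 + q/3) < r^2 / (1 - r)\<close>. Both fail
  for every \<open>0 \<le> r \<le> 2/3\<close>, with equality at \<open>r = 2/3\<close>.
\<close>

text \<open>The triangle inequality for \<open>(1 - c * z) * (\<Sum>k\<le>n. a k * z^k) = 0\<close>, solved for the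
  constant coefficient.\<close>

lemma constant_coeff_le_of_root:
  fixes a :: "nat \<Rightarrow> real" and z :: complex
  assumes "(\<Sum>k\<le>n. of_real (a k) * z ^ k) = 0"
  shows "\<bar>a 0\<bar> \<le> (\<Sum>k<n. \<bar>a (Suc k) - c * a k\<bar> * norm z ^ Suc k)
                + \<bar>c * a n\<bar> * norm z ^ Suc n"
proof -
  have expand: "(1 - of_real c * z) * (\<Sum>k\<le>n. of_real (a k) * z ^ k)
      = of_real (a 0) + (\<Sum>k<n. of_real (a (Suc k) - c * a k) * z ^ Suc k)
        - of_real (c * a n) * z ^ Suc n" for n
    by (induction n) (simp_all add: algebra_simps)
  have "of_real (a 0) = of_real (c * a n) * z ^ Suc n
      - (\<Sum>k<n. of_real (a (Suc k) - c * a k) * z ^ Suc k)"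
    using expand[of n] assms by (simp add: algebra_simps)
  then have "\<bar>a 0\<bar> = norm (of_real (c * a n) * z ^ Suc n
      - (\<Sum>k<n. of_real (a (Suc k) - c * a k) * z ^ Suc k))"
    by (metis norm_of_real)
  also have "\<dots> \<le> norm (of_real (c * a n) * z ^ Suc n)
      + norm (\<Sum>k<n. of_real (a (Suc k) - c * a k) * z ^ Suc k)"
    by (rule norm_triangle_ineq4)
  also have "norm (\<Sum>k<n. of_real (a (Suc k) - c * a k) * z ^ Suc k)
      \<le> (\<Sum>k<n. \<bar>a (Suc k) - c * a k\<bar> * norm z ^ Suc k)"
    by (rule order_trans[OF norm_sum])
       (simp only: norm_mult norm_power norm_of_real order_refl)
  finally show ?thesis
    by (simp only: norm_mult norm_power norm_of_real add.commute add_le_cancel_left)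
qed

lemma collatz_odd:
  assumes "odd m"
  shows "real (collatz m) = (3 * real m + 1) / 2"
proof -
  have "2 * collatz m = 3 * m + 1"
    using assms by (simp only: collatz_def if_True) simp
  then have "real (2 * collatz m) = real (3 * m + 1)"
    by (rule arg_cong)
  then show ?thesis by simp
qed

lemma collatz_even: "even m \<Longrightarrow> real (collatz m) = real m / 2"
  by (simp add: collatz_def real_of_nat_div)

lemma abs_collatz_defect:
  "\<bar>real (collatz m) - 3 / 2 * real m\<bar> = 3 / 2 * real m - real (collatz m) + of_bool (odd m)"
  by (cases "even m") (auto simp: collatz_odd collatz_even field_simps)

text \<open>With \<open>c = 3/2\<close> in \<open>constant_coeff_le_of_root\<close>, replacing each defect by its negative lets
  the sum telescope; by \<open>abs_collatz_defect\<close> this costs 1 for each odd step.\<close>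

lemma root_inequality:
  fixes N :: nat and z :: complex
  defines "a \<equiv> \<lambda>k. (collatz ^^ k) N"
  assumes root: "(\<Sum>k\<le>n. of_nat (a k) * z ^ k) = 0"
  shows "(1 - 3 / 2 * norm z) * (\<Sum>k\<le>n. real (a k) * norm z ^ k)
           \<le> (\<Sum>k<n. of_bool (odd (a k)) * norm z ^ Suc k)"
proof -
  define r where "r = norm z"
  have step: "a (Suc k) = collatz (a k)" for k
    by (simp add: a_def)
  have telescope: "(\<Sum>k<n. (3 / 2 * real (a k) - real (a (Suc k))) * r ^ Suc k)
      + 3 / 2 * real (a n) * r ^ Suc n
      = real (a 0) - (1 - 3 / 2 * r) * (\<Sum>k\<le>n. real (a k) * r ^ k)" for n
    by (induction n) (simp_all add: algebra_simps)
  have "real (a 0) \<le> (\<Sum>k<n. \<bar>real (a (Suc k)) - 3 / 2 * real (a k)\<bar> * r ^ Suc k)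
      + 3 / 2 * real (a n) * r ^ Suc n"
    using constant_coeff_le_of_root[of "\<lambda>k. real (a k)" z n "3 / 2"] root
    by (simp add: r_def)
  also have "(\<Sum>k<n. \<bar>real (a (Suc k)) - 3 / 2 * real (a k)\<bar> * r ^ Suc k)
      = (\<Sum>k<n. (3 / 2 * real (a k) - real (a (Suc k))) * r ^ Suc k)
        + (\<Sum>k<n. of_bool (odd (a k)) * r ^ Suc k)"
    unfolding step abs_collatz_defect by (simp only: distrib_right sum.distrib)
  finally show ?thesis
    using telescope[of n] by (simp add: r_def)
qed

lemma sum_power_Suc_le:
  fixes r :: real
  assumes "0 \<le> r" "r < 1"
  shows "(\<Sum>k<n. r ^ Suc k) \<le> r / (1 - r)"
proof -
  have "(\<Sum>k<n. r ^ Suc k) = r * (1 - r ^ n) / (1 - r)"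
    using assms sum_gp_strict[of r n] by (simp flip: sum_distrib_left)
  also have "\<dots> \<le> r / (1 - r)"
    using assms by (intro divide_right_mono) (auto simp: mult_left_le)
  finally show ?thesis .
qed

text \<open>Both inequalities factor with \<open>2 - 3 * r\<close>, which vanishes at the limiting value of the
  bound as \<open>N\<close> grows.\<close>

lemma odd_case_inequality:
  fixes r :: real
  assumes "0 \<le> r" "r \<le> 2 / 3"
  shows "r / (1 - r) \<le> 3 / 2 * r * (1 + 3 / 2 * r)"
proof -
  have "0 \<le> r * ((2 - 3 * r) * (1 + 3 * r))"
    using assms by (intro mult_nonneg_nonneg) auto
  then have "r \<le> 3 / 2 * r * (1 + 3 / 2 * r) * (1 - r)"
    by (simp add: field_simps)
  then show ?thesis
    using assms by (subst pos_divide_le_eq) auto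
qed

lemma even_case_inequality:
  fixes r :: real
  assumes "0 \<le> r" "r \<le> 2 / 3"
  shows "r / (1 - r) - r \<le> 3 / 2 * r * (1 + r / 2)"
proof -
  have "0 \<le> r * ((2 - 3 * r) * (3 + r))"
    using assms by (intro mult_nonneg_nonneg) auto
  then have "r \<le> (3 / 2 * r * (1 + r / 2) + r) * (1 - r)"
    by (simp add: field_simps)
  then have "r / (1 - r) \<le> 3 / 2 * r * (1 + r / 2) + r"
    using assms by (subst pos_divide_le_eq) auto
  then show ?thesis by linarith
qed

text \<open>The hypothesis \<open>n > 0\<close> makes the first iterate a coefficient; it contributes the factors
  \<open>1 + 3/2 * r\<close> and \<open>1 + r/2\<close>.\<close>

lemma root_bound_truncated:
  fixes N :: nat and z :: complex
  assumes "n > 0" and root: "(\<Sum>k\<le>n. of_nat ((collatz ^^ k) N) * z ^ k) = 0"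
  shows "real N * (1 - 3 / 2 * norm z) \<le> 3 / 2 * norm z"
proof (rule ccontr)
  define r where "r = norm z"
  define S where "S = (\<Sum>k\<le>n. real ((collatz ^^ k) N) * r ^ k)"
  define T where "T = (\<Sum>k<n. of_bool (odd ((collatz ^^ k) N)) * r ^ Suc k)"
  assume "\<not> ?thesis"
  then have large: "3 / 2 * r < real N * (1 - 3 / 2 * r)"
    by (simp add: r_def)
  have r0: "0 \<le> r"
    by (simp add: r_def)
  have r1: "r < 2 / 3"
  proof (rule ccontr)
    assume "\<not> r < 2 / 3"
    then have "real N * (1 - 3 / 2 * r) \<le> 0"
      by (intro mult_nonneg_nonpos) auto
    then show False
      using large r0 by linarith
  qed
  have main: "(1 - 3 / 2 * r) * S \<le> T"
    using root_inequality[OF root] by (simp add: r_def S_def T_def)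
  have "(\<Sum>k\<in>{0, 1}. real ((collatz ^^ k) N) * r ^ k) \<le> S"
    unfolding S_def using \<open>n > 0\<close> r0 by (intro sum_mono2) auto
  then have two_terms: "real N + real (collatz N) * r \<le> S"
    by simp
  have lower: "3 / 2 * r * (1 + t) < T" if "t \<ge> 0" and "real N * (1 + t) \<le> S" for t
  proof -
    have "3 / 2 * r * (1 + t) < real N * (1 - 3 / 2 * r) * (1 + t)"
      using large that(1) by (intro mult_strict_right_mono) auto
    also have "\<dots> = (1 - 3 / 2 * r) * (real N * (1 + t))"
      by simp
    also have "\<dots> \<le> (1 - 3 / 2 * r) * S"
      using that(2) r1 by (intro mult_left_mono) auto
    finally show ?thesis
      using main by linarith
  qed
  have geometric: "(\<Sum>k<n. r ^ Suc k) \<le> r / (1 - r)"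
    using r0 r1 by (intro sum_power_Suc_le) auto
  show False
  proof (cases "odd N")
    case True
    have "real N * (1 + 3 / 2 * r) \<le> S"
      using two_terms True r0 by (simp add: collatz_odd field_simps)
    then have "3 / 2 * r * (1 + 3 / 2 * r) < T"
      using r0 by (intro lower) auto
    also have "T \<le> (\<Sum>k<n. r ^ Suc k)"
      unfolding T_def using r0 by (intro sum_mono) auto
    also note geometric
    also have "r / (1 - r) \<le> 3 / 2 * r * (1 + 3 / 2 * r)"
      using r0 r1 by (intro odd_case_inequality) auto
    finally show False by simp
  next
    case False
    have "real N * (1 + r / 2) \<le> S"
      using two_terms False by (simp add: collatz_even field_simps)
    then have "3 / 2 * r * (1 + r / 2) < T"
      using r0 by (intro lower) auto
    also have "T \<le> (\<Sum>k<n. r ^ Suc k) - r"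
    proof -
      have "T = (\<Sum>k\<in>{..<n} - {0}. of_bool (odd ((collatz ^^ k) N)) * r ^ Suc k)"
        unfolding T_def using \<open>n > 0\<close> False by (subst sum.remove[of _ 0]) auto
      also have "\<dots> \<le> (\<Sum>k\<in>{..<n} - {0}. r ^ Suc k)"
        using r0 by (intro sum_mono) auto
      also have "\<dots> = (\<Sum>k<n. r ^ Suc k) - r"
        using \<open>n > 0\<close> by (subst sum.remove[of "{..<n}" 0]) auto
      finally show ?thesis .
    qed
    also have "\<dots> \<le> r / (1 - r) - r"
      using geometric by simp
    also have "\<dots> \<le> 3 / 2 * r * (1 + r / 2)"
      using r0 r1 by (intro even_case_inequality) auto
    finally show False by simp
  qed
qed

lemma poly_collatz_poly:
  "poly (collatz_poly N) z = (\<Sum>k\<le>total_stopping_time N. of_nat ((collatz ^^ k) N) * z ^ k)"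
  by (simp add: collatz_poly_def collatz_coeff_def poly_sum poly_monom)

theorem mainTheorem2:
  fixes N :: nat and \<xi> :: complex
  assumes "N > 0"
    and "reaches_one N"
    and "poly (collatz_poly N) \<xi> = 0"
  shows "norm \<xi> \<ge> 2 / (3 * (1 + 1 / real N))"
proof -
  have root: "(\<Sum>k\<le>total_stopping_time N. of_nat ((collatz ^^ k) N) * \<xi> ^ k) = 0"
    using assms(3) by (simp add: poly_collatz_poly)
  (* With stopping time 0 the polynomial is the nonzero constant N. *)
  have "total_stopping_time N > 0"
    using root \<open>N > 0\<close> by (intro gr0I) auto
  then have "real N * (1 - 3 / 2 * norm \<xi>) \<le> 3 / 2 * norm \<xi>"
    using root by (rule root_bound_truncated)
  then have "2 * real N \<le> norm \<xi> * (3 * (real N + 1))"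
    by (simp add: algebra_simps)
  moreover have "2 / (3 * (1 + 1 / real N)) = 2 * real N / (3 * (real N + 1))"
    using \<open>N > 0\<close> by (simp add: field_simps)
  ultimately show ?thesis
    by (simp add: pos_divide_le_eq)
qed

end
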